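(* Let $(\Omega,\mathcal F,(\mathcal F_t)_{t\in[0,1]},\mathbb P)$ be a filtered probability space and let $S=(S_t)_{t\in[0,1]}$ be a progressively measurable, strictly positive process with continuous paths and deterministic initial value $S_0=s_0>0$. Assume that $S$ exhibits conditional full support, i.e. $$\operatorname{supp}\ \mathbb P\big[S|_{[t,1]}\in\cdot\,\big|\,\mathcal F_t\big]=C^+_{S_t}[t,1]\quad \mathbb P\text{-a.s. for every } t\in[0,1].$$ Let $\kappa>0$ and let $f:[0,\infty)\to\mathbb R$ be continuous and convex, with payoff $F=f(S_1)\ge 0$. Put $f'(\infty):=\sup_{s>0}f'(s)\in(-\infty,\infty]$. Then the super-replication price of $F=f(S_1)$ with fixed transaction costs $\kappa$ is $$\mathbb V^{\kappa}(f(S_1))=f(0)+s_0f'(\infty).$$ Moreover, if $f'(\infty)<\infty$, then a super-hedge with initial capital $\mathbb V^\kappa(f(S_1))$ is to buy $h_0:=f'(\infty)$ units of the asset at time $\tau_0=0$ and to hold these until time $1$ (no further interventions).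
   Context: For $y\ge 0$, $C^+_y[t,1]$ denotes the space of all continuous paths $[t,1]\to\mathbb R_+$ that start in $y$ at time $t$ (with the topology of uniform convergence); $\operatorname{supp}$ denotes the topological support of the (regular) conditional law. $f'$ denotes a one-sided derivative of the convex function $f$ (the supremum does not depend on which one). Trading strategies. An intervention system is a sequence $\mathbb T=(\tau_i)_{i=0,1,2,\dots}$ of $(\mathcal F_t)$-stopping times with $0=\tau_0\le\tau_1\le\tau_2\le\dots\le 1$ and $\tau_i<\tau_{i+1}$ on $\{\tau_i<1\}$. Let $\mathscr T$ be the class of all such $\mathbb T$ for which $N(\mathbb T):=\sup\{i=0,1,\dots:\tau_i<1\}<\infty$ $\mathbb P$-a.s. A strategy is a pair $(\mathbb T,\mathbb H)$ with $\mathbb T\in\mathscr T$ and $\mathbb H=(h_i)_{i=0,1,\dots}$, where $h_i$ is a real-valued $\mathcal F_{\tau_i}$-measurable random variable (the number of assets held over $(\tau_i,\tau_{i+1}]$). Its gains process with fixed costs $\kappa$ (the trade at time $0$ being free) is $$G^\kappa(\mathbb T,\mathbb H)_t:=\sum_{i=0,1,\dots}h_i\,(S_{\tau_{i+1}\wedge t}-S_{\tau_i\wedge t})-\kappa\,\sup\{i=0,1,\dots:\tau_i<t\},\quad t\in[0,1],$$ with $\sup\emptyset:=0$. The set $\mathscr A$ of admissible strategies consists of all $(\mathbb T,\mathbb H)$ such that the process $G^\kappa(\mathbb T,\mathbb H)$ is $\mathbb P$-a.s. bounded from below by a (deterministic) constant. For an $\mathcal F_1$-measurable payoff $F\ge 0$,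 the super-replication price is $$\mathbb V^\kappa(F):=\inf\{x\in\mathbb R: x+G^\kappa(\mathbb T,\mathbb H)_1\ge F\ \ \mathbb P\text{-a.s. for some }(\mathbb T,\mathbb H)\in\mathscr A\},$$ with $\inf\emptyset=+\infty$. *)

theory Defs
  imports "HOL-Probability.Probability"
begin

text \<open>
  Time is a real number and only the times in \<open>{0..1}\<close> matter. Filtrations are indexed by all reals so
  that the library's \<^term>\<open>filtration\<close>, \<^term>\<open>stopping_time\<close> and \<open>pre_sigma\<close> apply; a filtration
  \<open>(F\<^sub>t)\<close> on \<open>{0..1}\<close> extends to the reals by \<open>F\<^sub>t = F\<^sub>0\<close> for \<open>t < 0\<close> and \<open>F\<^sub>t = F\<^sub>1\<close> for \<open>t > 1\<close>.
  For random times with values in \<open>{0..1}\<close>, being a stopping time and the \<open>\<sigma>\<close>-algebra of events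
  prior to it depend on \<open>(F\<^sub>t)\<close> for \<open>t\<close> in \<open>{0..1}\<close> only.
\<close>

definition progressively_measurable :: "(real \<Rightarrow> 'a measure) \<Rightarrow> (real \<Rightarrow> 'a \<Rightarrow> real) \<Rightarrow> bool" where
  "progressively_measurable F S \<longleftrightarrow>
     (\<forall>t\<in>{0..1}. (\<lambda>(s, \<omega>). S s \<omega>) \<in> borel_measurable (restrict_space borel {0..t} \<Otimes>\<^sub>M F t))"

definition borel_of_topology :: "'b topology \<Rightarrow> 'b measure" where
  "borel_of_topology X = sigma (topspace X) {U. openin X U}"

definition topological_support :: "'b topology \<Rightarrow> 'b measure \<Rightarrow> 'b set" where
  "topological_support X \<mu> = {x \<in> topspace X. \<forall>U. openin X U \<and> x \<in> U \<longrightarrow> 0 < emeasure \<mu> U}"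

text \<open>\<open>K\<close> is a regular version of the conditional law of the \<open>N\<close>-valued random variable \<open>X\<close> given the
  sub-\<open>\<sigma>\<close>-algebra \<open>G\<close> of \<open>M\<close>.\<close>

definition regular_conditional_law ::
    "'a measure \<Rightarrow> 'a measure \<Rightarrow> 'b measure \<Rightarrow> ('a \<Rightarrow> 'b) \<Rightarrow> ('a \<Rightarrow> 'b measure) \<Rightarrow> bool" where
  "regular_conditional_law M G N X K \<longleftrightarrow>
     K \<in> measurable G (prob_algebra N) \<and>
     (\<forall>B\<in>sets N. AE \<omega> in M.
        measure (K \<omega>) B = real_cond_exp M G (indicator (X -` B \<inter> space M)) \<omega>)"

text \<open>The space of continuous paths from \<open>{t..1}\<close> to \<open>{0..}\<close> with the uniform distance. As for every
  \<^const>\<open>cfunspace\<close>, its elements are extensional, i.e. \<open>undefined\<close> outside \<open>{t..1}\<close>.\<close>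

definition path_space :: "real \<Rightarrow> (real \<Rightarrow> real) metric" where
  "path_space t = cfunspace (top_of_set {t..1}) (submetric euclidean_metric {0..})"

definition paths_from :: "real \<Rightarrow> real \<Rightarrow> (real \<Rightarrow> real) set" where
  "paths_from y t = {w \<in> mspace (path_space t). w t = y}"

text \<open>The path space is Polish, so a regular conditional law exists and is unique up to a null set;
  hence the choice of \<open>K\<close> does not matter.\<close>

definition conditional_full_support ::
    "'a measure \<Rightarrow> (real \<Rightarrow> 'a measure) \<Rightarrow> (real \<Rightarrow> 'a \<Rightarrow> real) \<Rightarrow> bool" where
  "conditional_full_support M F S \<longleftrightarrow>
     (\<forall>t\<in>{0..1}. \<exists>K.
        regular_conditional_law M (F t) (borel_of_topology (mtopology_of (path_space t)))
          (\<lambda>\<omega>. restrict (\<lambda>s. S s \<omega>) {t..1}) K \<and>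
        (AE \<omega> in M. topological_support (mtopology_of (path_space t)) (K \<omega>) = paths_from (S t \<omega>) t))"

definition last_intervention_before :: "(nat \<Rightarrow> 'a \<Rightarrow> real) \<Rightarrow> real \<Rightarrow> 'a \<Rightarrow> enat" where
  "last_intervention_before \<tau> t \<omega> = (SUP i\<in>{i. \<tau> i \<omega> < t}. enat i)"

definition intervention_system ::
    "'a measure \<Rightarrow> (real \<Rightarrow> 'a measure) \<Rightarrow> (nat \<Rightarrow> 'a \<Rightarrow> real) \<Rightarrow> bool" where
  "intervention_system M F \<tau> \<longleftrightarrow>
     (\<forall>i. stopping_time F (\<tau> i)) \<and>
     (\<forall>\<omega>\<in>space M. \<tau> 0 \<omega> = 0) \<and>
     (\<forall>i. \<forall>\<omega>\<in>space M. \<tau> i \<omega> \<le> \<tau> (Suc i) \<omega> \<and> \<tau> i \<omega> \<le> 1) \<and>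
     (\<forall>i. \<forall>\<omega>\<in>space M. \<tau> i \<omega> < 1 \<longrightarrow> \<tau> i \<omega> < \<tau> (Suc i) \<omega>)"

definition strategy ::
    "'a measure \<Rightarrow> (real \<Rightarrow> 'a measure) \<Rightarrow> (nat \<Rightarrow> 'a \<Rightarrow> real) \<Rightarrow> (nat \<Rightarrow> 'a \<Rightarrow> real) \<Rightarrow> bool" where
  "strategy M F \<tau> h \<longleftrightarrow>
     intervention_system M F \<tau> \<and>
     (AE \<omega> in M. last_intervention_before \<tau> 1 \<omega> < \<infinity>) \<and>
     (\<forall>i. h i \<in> borel_measurable (filtration.pre_sigma (space M) F (\<tau> i)))"

text \<open>For a strategy, almost surely only finitely many terms of the series are nonzero and the number of
  paid interventions is finite at all times; on the exceptional null set the value is irrelevant.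
  The supremum of the empty set is \<open>0\<close> in \<^typ>\<open>enat\<close>.\<close>

definition gains ::
    "real \<Rightarrow> (real \<Rightarrow> 'a \<Rightarrow> real) \<Rightarrow> (nat \<Rightarrow> 'a \<Rightarrow> real) \<Rightarrow> (nat \<Rightarrow> 'a \<Rightarrow> real) \<Rightarrow> real \<Rightarrow> 'a \<Rightarrow> real" where
  "gains \<kappa> S \<tau> h t \<omega> =
     (\<Sum>i. h i \<omega> * (S (min (\<tau> (Suc i) \<omega>) t) \<omega> - S (min (\<tau> i \<omega>) t) \<omega>))
     - \<kappa> * real (the_enat (last_intervention_before \<tau> t \<omega>))"

definition admissible ::
    "'a measure \<Rightarrow> (real \<Rightarrow> 'a measure) \<Rightarrow> (real \<Rightarrow> 'a \<Rightarrow> real) \<Rightarrow> real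
     \<Rightarrow> (nat \<Rightarrow> 'a \<Rightarrow> real) \<Rightarrow> (nat \<Rightarrow> 'a \<Rightarrow> real) \<Rightarrow> bool" where
  "admissible M F S \<kappa> \<tau> h \<longleftrightarrow>
     strategy M F \<tau> h \<and> (\<exists>c::real. AE \<omega> in M. \<forall>t\<in>{0..1}. c \<le> gains \<kappa> S \<tau> h t \<omega>)"

definition super_hedge ::
    "'a measure \<Rightarrow> (real \<Rightarrow> 'a measure) \<Rightarrow> (real \<Rightarrow> 'a \<Rightarrow> real) \<Rightarrow> real \<Rightarrow> ('a \<Rightarrow> real) \<Rightarrow> real
     \<Rightarrow> (nat \<Rightarrow> 'a \<Rightarrow> real) \<Rightarrow> (nat \<Rightarrow> 'a \<Rightarrow> real) \<Rightarrow> bool" where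
  "super_hedge M F S \<kappa> P x \<tau> h \<longleftrightarrow>
     admissible M F S \<kappa> \<tau> h \<and> (AE \<omega> in M. x + gains \<kappa> S \<tau> h 1 \<omega> \<ge> P \<omega>)"

definition super_replication_price ::
    "'a measure \<Rightarrow> (real \<Rightarrow> 'a measure) \<Rightarrow> (real \<Rightarrow> 'a \<Rightarrow> real) \<Rightarrow> real \<Rightarrow> ('a \<Rightarrow> real) \<Rightarrow> ereal" where
  "super_replication_price M F S \<kappa> P =
     (INF x\<in>{x::real. \<exists>\<tau> h. super_hedge M F S \<kappa> P x \<tau> h}. ereal x)"

text \<open>The one-sided derivative is selected by \<open>side\<close>, which is \<^term>\<open>at_left\<close> or \<^term>\<open>at_right\<close>.\<close>

definition slope_at_infinity :: "(real \<Rightarrow> real filter) \<Rightarrow> (real \<Rightarrow> real) \<Rightarrow> ereal" where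
  "slope_at_infinity side f = (SUP s\<in>{0<..}. ereal (vector_derivative f (side s)))"

definition no_later_interventions :: "nat \<Rightarrow> 'a \<Rightarrow> real" where
  "no_later_interventions i \<omega> = (if i = 0 then 0 else 1)"

definition initial_holding :: "real \<Rightarrow> nat \<Rightarrow> 'a \<Rightarrow> real" where
  "initial_holding a i \<omega> = (if i = 0 then a else 0)"

end

theory Submission
  imports Defs
begin

text \<open>
  Buying \<open>f'(\<infinity>)\<close> assets and holding them dominates the payoff, because
  \<open>f y \<le> f 0 + f'(\<infinity>) * y\<close>.

  For the converse let \<open>d = f' s\<close> for some \<open>s > 0\<close>, so that \<open>f y \<ge> d * y - C\<close>, and suppose that the
  initial capital is less than \<open>f 0 + s0 * d\<close>. The adversary chooses the price path: while the holding
  is at least \<open>d\<close> the price goes to \<open>0\<close>, otherwise it goes far up. Either way wealth minus \<open>d\<close> times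
  price does not improve, and the super-hedge fails unless the trader intervenes and pays \<open>\<kappa>\<close>. After
  finitely many interventions the wealth lies below \<open>d * S - C - 1\<close>. Then the price is frozen. Again
  the trader can only keep intervening, until the wealth violates the admissibility bound. By conditional
  full support, each of these finitely many stages follows the adversary's path up to a small error with
  positive probability. Events of positive (outer) probability are expressed by \<open>\<exists>\<^sub>F \<omega> in ae_filter M\<close>,
  which is monotone without any measurability.
\<close>

subsection \<open>One-sided derivatives of convex functions\<close>

text \<open>Difference quotients at an interior point are monotone, so they converge from either
  side. A quotient taken on the opposite side bounds them and makes the limit finite.\<close>

lemma convex_on_one_sided_derivative:
  fixes f :: "real \<Rightarrow> real"
  assumes cvx: "convex_on {0..} f" and s: "0 < s" and side: "side \<in> {at_left, at_right}"
  shows "(f has_vector_derivative vector_derivative f (side s)) (side s)"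
proof -
  let ?g = "\<lambda>t. (f t - f s) / (t - s)"
  have sym: "?g t = (f s - f t) / (s - t)" for t
    by (metis minus_diff_eq minus_divide_divide)
  have up: "?g a \<le> ?g b" if "s < a" "a \<le> b" for a b
    using convex_on_slope_le(1)[OF cvx, of s b a] that s by (cases "a = b") (auto simp: sym)
  have down: "?g a \<le> ?g b" if "0 \<le> a" "a \<le> b" "b < s" for a b
    using convex_on_slope_le(2)[OF cvx, of a s b] that s by (cases "a = b") auto
  have across: "?g a \<le> ?g b" if "0 \<le> a" "a < s" "s < b" for a b
  proof -
    have "?g a \<le> (f a - f b) / (a - b)" "(f a - f b) / (a - b) \<le> ?g b"
      using convex_on_slope_le[OF cvx, of a b s] that s by (auto simp: sym)
    then show ?thesis by linarith
  qed
  have "\<exists>l. (?g \<longlongrightarrow> l) (side s)"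
  proof (cases "side = at_right")
    case True
    have "(?g \<longlongrightarrow> Inf (?g ` ({s<..} \<inter> UNIV))) (at s within ({s<..} \<inter> UNIV))"
      by (rule Lim_right_bound[where K="?g 0"]) (blast intro: up, use across[of 0] s in simp)
    then show ?thesis using True by auto
  next
    case False
    \<comment> \<open>Convexity is available on the nonnegative half-line only. Cutting left
      neighbourhoods down to positive arguments does not change \<open>at_left s\<close>, because
      \<open>s\<close> is interior.\<close>
    have "(?g \<longlongrightarrow> Sup (?g ` ({..<s} \<inter> {0<..}))) (at s within ({..<s} \<inter> {0<..}))"
      by (rule Lim_left_bound[where K="?g (s + 1)"]) (use down across[of _ "s + 1"] s in \<open>auto simp del: add_diff_cancel_left'\<close>)
    moreover have "at s within ({..<s} \<inter> {0<..}) = at_left s"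
      using s by (intro at_within_nhd[where S="{0<..}"]) auto
    ultimately show ?thesis using False side by auto
  qed
  moreover obtain A where "side s = at s within A" using side by auto
  ultimately obtain l where "(f has_vector_derivative l) (side s)"
    by (auto simp: has_real_derivative_iff_has_vector_derivative[symmetric] has_field_derivative_iff)
  then show ?thesis
    using vector_derivative_works differentiableI_vector by blast
qed

text \<open>By monotonicity the quotient between \<open>s\<close> and \<open>y\<close> bounds all
  quotients at points near \<open>s\<close>, and the bound passes to the limit. Points near
  \<open>s\<close> lie on the same side of \<open>y\<close> from whichever direction they approach,
  so either one-sided derivative gives a supporting line on both sides of \<open>s\<close>.\<close>

lemma convex_on_one_sided_derivative_subgradient:
  fixes f :: "real \<Rightarrow> real"
  assumes cvx: "convex_on {0..} f" and s: "0 < s" and y: "0 \<le> y"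
    and side: "side \<in> {at_left, at_right}"
  shows "f s + vector_derivative f (side s) * (y - s) \<le> f y"
proof -
  let ?d = "vector_derivative f (side s)" and ?g = "\<lambda>t. (f t - f s) / (t - s)"
  have lim: "(?g \<longlongrightarrow> ?d) (side s)"
    using convex_on_one_sided_derivative[OF cvx s side] side
    by (auto simp: has_real_derivative_iff_has_vector_derivative[symmetric] has_field_derivative_iff)
  have nontriv: "side s \<noteq> bot" using side by auto
  have sym: "?g t = (f s - f t) / (s - t)" for t
    by (metis minus_diff_eq minus_divide_divide)
  have mono: "?g a \<le> ?g b" if ab: "0 \<le> a" "a < b" "a \<noteq> s" "b \<noteq> s" for a b
  proof -
    consider "s < a" | "b < s" | "a < s" "s < b" using ab by fastforce
    then show ?thesis
    proof cases
      case 1 then show ?thesis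
        using convex_on_slope_le(1)[OF cvx, of s b a] that s by (auto simp: sym)
    next
      case 2 then show ?thesis
        using convex_on_slope_le(2)[OF cvx, of a s b] that s by auto
    next
      case 3
      have "?g a \<le> (f a - f b) / (a - b)" "(f a - f b) / (a - b) \<le> ?g b"
        using convex_on_slope_le[OF cvx, of a b s] that s 3 by (auto simp: sym)
      then show ?thesis by linarith
    qed
  qed
  have ev: "\<forall>\<^sub>F t in side s. t \<noteq> s"
    using side by (auto simp: eventually_at_filter)
  consider "y = s" | "s < y" | "y < s" by linarith
  then show ?thesis
  proof cases
    case 1 then show ?thesis by simp
  next
    case 2
    have "(id \<longlongrightarrow> s) (side s)"
      using side by (auto simp: id_def)
    then have "\<forall>\<^sub>F t in side s. t > 0 \<and> t < y"
      using s 2 by (auto intro!: eventually_conj dest: order_tendstoD)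
    then have "\<forall>\<^sub>F t in side s. ?g t \<le> ?g y"
      using ev by eventually_elim (use mono 2 in auto)
    then have "?d \<le> ?g y"
      by (rule tendsto_upperbound[OF lim _ nontriv])
    then show ?thesis using 2 by (simp add: field_simps)
  next
    case 3
    have "(id \<longlongrightarrow> s) (side s)"
      using side by (auto simp: id_def)
    then have "\<forall>\<^sub>F t in side s. t > y"
      using 3 by (auto dest: order_tendstoD)
    then have "\<forall>\<^sub>F t in side s. ?g y \<le> ?g t"
      using ev by eventually_elim (use mono y 3 in auto)
    then have "?g y \<le> ?d"
      by (rule tendsto_lowerbound[OF lim _ nontriv])
    then show ?thesis using 3 by (simp add: field_simps)
  qed
qed

subsection \<open>Conditional full support at stopping times\<close>

text \<open>On a compact interval the boundedness built into \<open>cfunspace\<close> is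
  automatic.\<close>

lemma in_mspace_path_space:
  "w \<in> mspace (path_space t) \<longleftrightarrow>
     w \<in> extensional {t..1} \<and> (\<forall>s\<in>{t..1}. 0 \<le> w s) \<and> continuous_on {t..1} w"
proof -
  have "continuous_map (top_of_set {t..1}) (top_of_set {0..}) w \<longleftrightarrow>
      continuous_on {t..1} w \<and> w ` {t..1} \<subseteq> {0..}"
    by (simp add: continuous_map_in_subtopology image_subset_iff_funcset)
  then show ?thesis
    unfolding path_space_def
    by (subst compactin_mspace_cfunspace)
      (auto simp: mtopology_of_submetric compactin_subtopology)
qed

lemma mdist_path_space_le:
  assumes "t \<le> 1" "v \<in> mspace (path_space t)" "w \<in> mspace (path_space t)"
  shows "mdist (path_space t) v w \<le> r \<longleftrightarrow> (\<forall>s\<in>{t..1}. \<bar>v s - w s\<bar> \<le> r)"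
  using assms unfolding path_space_def by (subst cfunspace_mdist_le) (auto simp: dist_real_def)

text \<open>Turns a condition on a whole path into countably many, hence measurable, ones.
  Nondegeneracy of the interval matters: a single irrational point contains no rational
  time.\<close>

lemma continuous_abs_le_iff_rat:
  fixes g :: "real \<Rightarrow> real"
  assumes "a < b" "continuous_on {a..b} g"
  shows "(\<forall>t\<in>{a..b}. \<bar>g t\<bar> \<le> r) \<longleftrightarrow> (\<forall>t\<in>\<rat> \<inter> {a..b}. \<bar>g t\<bar> \<le> r)"
proof
  assume *: "\<forall>t\<in>\<rat> \<inter> {a..b}. \<bar>g t\<bar> \<le> r"
  show "\<forall>t\<in>{a..b}. \<bar>g t\<bar> \<le> r"
  proof (rule ccontr)
    assume "\<not> ?thesis"
    then obtain t where t: "t \<in> {a..b}" "r < \<bar>g t\<bar>" by (auto simp: not_le)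
    have "((\<lambda>t. \<bar>g t\<bar>) \<longlongrightarrow> \<bar>g t\<bar>) (at t within {a..b})"
      using assms(2) t by (auto simp: continuous_on_def intro!: tendsto_intros)
    then have "\<forall>\<^sub>F u in at t within {a..b}. r < \<bar>g u\<bar>"
      using t by (auto dest: order_tendstoD)
    then obtain \<delta> where \<delta>: "0 < \<delta>" "\<And>u. u \<in> {a..b} \<Longrightarrow> u \<noteq> t \<Longrightarrow> dist u t < \<delta> \<Longrightarrow> r < \<bar>g u\<bar>"
      by (auto simp: eventually_at)
    obtain u where u: "u \<in> \<rat>" "max a (t - \<delta>) < u" "u < min b (t + \<delta>)"
      using Rats_dense_in_real[of "max a (t - \<delta>)" "min b (t + \<delta>)"] assms(1) t \<delta>(1) by auto
    then show False
      using \<delta>(2)[of u] * t by (cases "u = t") (force simp: dist_real_def)+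
  qed
qed auto

section \<open>Prices at random times, and conditional full support at a deterministic time\<close>

locale cfs_market = prob_space M + filtration "space M" F
  for M :: "'a measure" and F :: "real \<Rightarrow> 'a measure" +
  fixes S :: "real \<Rightarrow> 'a \<Rightarrow> real" and s0 :: real
  assumes subalg_F: "t \<in> {0..1} \<Longrightarrow> subalgebra M (F t)"
    and prog: "progressively_measurable F S"
    and S_pos: "t \<in> {0..1} \<Longrightarrow> \<omega> \<in> space M \<Longrightarrow> 0 < S t \<omega>"
    and S_cont: "\<omega> \<in> space M \<Longrightarrow> continuous_on {0..1} (\<lambda>t. S t \<omega>)"
    and S_0: "\<omega> \<in> space M \<Longrightarrow> S 0 \<omega> = s0"
    and cfs: "conditional_full_support M F S"
begin

lemma borel_measurable_S_time:
  assumes t: "t \<in> {0..1}" and T: "T \<in> borel_measurable (F t)"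
    and T_range: "\<And>\<omega>. \<omega> \<in> space M \<Longrightarrow> T \<omega> \<in> {0..t}"
  shows "(\<lambda>\<omega>. S (T \<omega>) \<omega>) \<in> borel_measurable (F t)"
proof -
  have "(\<lambda>(s, \<omega>). S s \<omega>) \<in> borel_measurable (restrict_space borel {0..t} \<Otimes>\<^sub>M F t)"
    using prog t by (simp add: progressively_measurable_def)
  from _ this have "(\<lambda>\<omega>. case (T \<omega>, \<omega>) of (s, \<omega>) \<Rightarrow> S s \<omega>) \<in> borel_measurable (F t)"
  proof (rule measurable_compose)
    show "(\<lambda>\<omega>. (T \<omega>, \<omega>)) \<in> F t \<rightarrow>\<^sub>M restrict_space borel {0..t} \<Otimes>\<^sub>M F t"
      using T T_range by (intro measurable_Pair measurable_restrict_space2) (auto simp: space_F)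
  qed
  then show ?thesis by simp
qed

lemma borel_measurable_S_F: "t \<in> {0..1} \<Longrightarrow> t \<le> u \<Longrightarrow> S t \<in> borel_measurable (F u)"
  using borel_measurable_S_time[of t "\<lambda>_. t"] measurable_mono[of borel borel "F t" "F u"] sets_F_mono[of t u]
  by (auto simp: space_F)

lemma borel_measurable_S [measurable]: "t \<in> {0..1} \<Longrightarrow> S t \<in> borel_measurable M"
  using borel_measurable_S_F[of t t] measurable_from_subalg[OF subalg_F] by blast

text \<open>On \<open>{T \<le> t}\<close> the price at \<open>T\<close> is the price at
  \<open>min T t\<close>, a time known at \<open>t\<close> and not after it, so progressive
  measurability at \<open>t\<close> applies. Values of \<open>t\<close> outside the unit interval
  lead to the empty event or back to \<open>t = 1\<close>.\<close>

lemma borel_measurable_S_stopping_time: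
  assumes T: "stopping_time F T" and T_range: "\<And>\<omega>. \<omega> \<in> space M \<Longrightarrow> T \<omega> \<in> {0..1}"
  shows "(\<lambda>\<omega>. S (T \<omega>) \<omega>) \<in> borel_measurable (pre_sigma T)"
proof (rule borel_measurableI)
  fix B :: "real set" assume "open B"
  then have [measurable]: "B \<in> sets borel" by simp
  have unit: "{\<omega> \<in> space M. S (T \<omega>) \<omega> \<in> B \<and> T \<omega> \<le> t} \<in> sets (F t)" if t: "t \<in> {0..1}" for t
  proof -
    have [measurable]: "Measurable.pred (F t) (\<lambda>\<omega>. T \<omega> \<le> t)"
      by (rule stopping_timeD[OF T])
    have "(\<lambda>\<omega>. min (T \<omega>) t) \<in> borel_measurable (F t)"
    proof (rule borel_measurableI_le)
      fix r
      have "Measurable.pred (F t) (\<lambda>\<omega>. T \<omega> \<le> min r t)"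
        by (rule stopping_time_le_const[OF T]) simp
      then show "{\<omega> \<in> space (F t). min (T \<omega>) t \<le> r} \<in> sets (F t)"
        by (cases "t \<le> r") (simp_all add: pred_def min_le_iff_disj min_absorb1)
    qed
    from borel_measurable_S_time[OF t this]
    have [measurable]: "(\<lambda>\<omega>. S (min (T \<omega>) t) \<omega>) \<in> borel_measurable (F t)"
      using T_range t by auto
    have "{\<omega> \<in> space (F t). S (min (T \<omega>) t) \<omega> \<in> B \<and> T \<omega> \<le> t} \<in> sets (F t)"
      by measurable
    also have "{\<omega> \<in> space (F t). S (min (T \<omega>) t) \<omega> \<in> B \<and> T \<omega> \<le> t} =
        {\<omega> \<in> space M. S (T \<omega>) \<omega> \<in> B \<and> T \<omega> \<le> t}"
      by (auto simp: space_F min_def)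
    finally show ?thesis .
  qed
  have "{\<omega> \<in> space M. S (T \<omega>) \<omega> \<in> B \<and> T \<omega> \<le> t} \<in> sets (F t)" for t
  proof -
    consider "t < 0" | "t \<in> {0..1}" | "1 < t" by (meson atLeastAtMost_iff not_le)
    then show ?thesis
    proof cases
      case 1
      then have empty: "{\<omega> \<in> space M. S (T \<omega>) \<omega> \<in> B \<and> T \<omega> \<le> t} = {}"
        by (auto dest!: T_range)
      show ?thesis unfolding empty by simp
    next
      case 3
      then have "{\<omega> \<in> space M. S (T \<omega>) \<omega> \<in> B \<and> T \<omega> \<le> t} =
          {\<omega> \<in> space M. S (T \<omega>) \<omega> \<in> B \<and> T \<omega> \<le> 1}"
        by (auto dest: T_range)
      then show ?thesis using unit[of 1] sets_F_mono[of 1 t] 3 by auto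
    qed (rule unit)
  qed
  moreover have "{\<omega> \<in> (\<lambda>\<omega>. S (T \<omega>) \<omega>) -` B \<inter> space (pre_sigma T). T \<omega> \<le> t} =
      {\<omega> \<in> space M. S (T \<omega>) \<omega> \<in> B \<and> T \<omega> \<le> t}" for t
    by (auto simp: space_pre_sigma)
  ultimately show "(\<lambda>\<omega>. S (T \<omega>) \<omega>) -` B \<inter> space (pre_sigma T) \<in> sets (pre_sigma T)"
    by (intro sets_pre_sigmaI[OF T]) simp
qed

lemma restrict_S_in_path_space:
  assumes "\<omega> \<in> space M" "0 \<le> q"
  shows "restrict (\<lambda>s. S s \<omega>) {q..1} \<in> mspace (path_space q)"
proof -
  have "continuous_on {q..1} (\<lambda>s. S s \<omega>)"
    using assms by (intro continuous_on_subset[OF S_cont[of \<omega>]]) auto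
  moreover have "0 \<le> S s \<omega>" if "s \<in> {q..1}" for s
    using assms S_pos[of s \<omega>] that by auto
  ultimately show ?thesis
    unfolding in_mspace_path_space by (simp cong: continuous_on_cong_simp)
qed

text \<open>Where the price at \<open>q\<close> is within \<open>e\<close> of
  \<open>\<phi> q\<close>, the open \<open>e\<close>-ball around \<open>\<phi>\<close> contains a
  path starting at the actual price, so full support gives the ball positive conditional
  probability. As \<open>A\<close> is known at \<open>q\<close>, this positivity carries over to the
  joint event.\<close>

lemma frequently_near_path:
  assumes q: "0 \<le> q" "q < 1" and A: "A \<in> sets (F q)"
    and \<phi>: "continuous_on {q..1} \<phi>" "\<And>t. t \<in> {q..1} \<Longrightarrow> 0 \<le> \<phi> t"
    and freq: "\<exists>\<^sub>F \<omega> in ae_filter M. \<omega> \<in> A \<and> \<bar>S q \<omega> - \<phi> q\<bar> < e"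
  shows "\<exists>\<^sub>F \<omega> in ae_filter M. \<omega> \<in> A \<and> (\<forall>t\<in>{q..1}. \<bar>S t \<omega> - \<phi> t\<bar> < e)"
proof -
  define X where "X = (\<lambda>\<omega>. restrict (\<lambda>s. S s \<omega>) {q..1})"
  define v where "v = restrict \<phi> {q..1}"
  define U where "U = mball_of (path_space q) v e"
  let ?T = "mtopology_of (path_space q)"
  interpret P: Metric_space "mspace (path_space q)" "mdist (path_space q)"
    by (rule Metric_space_mspace_mdist)
  obtain K where K: "regular_conditional_law M (F q) (borel_of_topology ?T) X K"
    and supp: "AE \<omega> in M. topological_support ?T (K \<omega>) = paths_from (S q \<omega>) q"
    using bspec[OF cfs[unfolded conditional_full_support_def], of q] q unfolding X_def by auto
  have v: "v \<in> mspace (path_space q)"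
    using \<phi> unfolding in_mspace_path_space v_def by (simp cong: continuous_on_cong_simp)
  have X: "X \<omega> \<in> mspace (path_space q)" if "\<omega> \<in> space M" for \<omega>
    using restrict_S_in_path_space[of \<omega> q] that q by (simp add: X_def)
  have openU: "openin ?T U"
    by (simp add: U_def mball_of_def mtopology_of_def)
  have U: "U \<in> sets (borel_of_topology ?T)"
    unfolding borel_of_topology_def
    by (subst sets_measure_of) (blast dest: openin_subset, use openU in auto)
  have dist_le: "mdist (path_space q) v (X \<omega>) \<le> r \<longleftrightarrow> (\<forall>t\<in>{q..1}. \<bar>S t \<omega> - \<phi> t\<bar> \<le> r)"
    if "\<omega> \<in> space M" for \<omega> r
    using q by (subst mdist_path_space_le[OF _ v X[OF that]]) (auto simp: v_def X_def abs_minus_commute)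
  \<comment> \<open>A rational radius and rational times describe the ball through single prices
    \<open>S t\<close>. This makes \<open>B\<close> measurable without appeal to measurability of
    the path-valued map \<open>X\<close>.\<close>
  have XU_iff: "X \<omega> \<in> U \<longleftrightarrow> (\<exists>r\<in>\<rat>. r < e \<and> (\<forall>t\<in>\<rat> \<inter> {q..1}. \<bar>S t \<omega> - \<phi> t\<bar> \<le> r))"
    if \<omega>: "\<omega> \<in> space M" for \<omega>
  proof -
    have "X \<omega> \<in> U \<longleftrightarrow> (\<exists>r\<in>\<rat>. r < e \<and> mdist (path_space q) v (X \<omega>) \<le> r)"
      using X[OF \<omega>] v Rats_dense_in_real[of "mdist (path_space q) v (X \<omega>)" e] unfolding U_def
      by (auto intro: less_imp_le le_less_trans)
    also have "\<dots> \<longleftrightarrow> (\<exists>r\<in>\<rat>. r < e \<and> (\<forall>t\<in>\<rat> \<inter> {q..1}. \<bar>S t \<omega> - \<phi> t\<bar> \<le> r))"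
      using continuous_on_subset[OF S_cont[OF \<omega>], of "{q..1}"] \<phi>(1) q
      by (subst dist_le[OF \<omega>], subst continuous_abs_le_iff_rat) (auto intro!: continuous_on_diff)
    finally show ?thesis .
  qed
  define B where "B = X -` U \<inter> space M"
  have B_eq: "B = {\<omega> \<in> space M. \<exists>r\<in>\<rat>. r < e \<and> (\<forall>t\<in>\<rat> \<inter> {q..1}. \<bar>S t \<omega> - \<phi> t\<bar> \<le> r)}"
    using XU_iff by (auto simp: B_def)
  have [measurable]: "B \<in> sets M"
  proof -
    have [measurable]: "Measurable.pred M (\<lambda>\<omega>. \<bar>S t \<omega> - \<phi> t\<bar> \<le> r)" if "t \<in> {q..1}" for t r
    proof -
      have [measurable]: "S t \<in> borel_measurable M" using that q by (intro borel_measurable_S) auto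
      show ?thesis by measurable
    qed
    have "Measurable.pred M (\<lambda>\<omega>. \<exists>r\<in>\<rat>. r < e \<and> (\<forall>t\<in>\<rat> \<inter> {q..1}. \<bar>S t \<omega> - \<phi> t\<bar> \<le> r))"
      by (intro measurable_pred_countable pred_intros_logic ballI countable_rat)
        (auto simp: countable_rat)
    then show ?thesis by (simp add: B_eq pred_def)
  qed
  have sub: "subalgebra M (F q)" using subalg_F q by auto
  interpret finite_measure_subalgebra M "F q"
    by unfold_locales (rule sub)
  have [measurable]: "A \<in> sets M" using A sub by (auto simp: subalgebra_def)
  have KU: "AE \<omega> in M. measure (K \<omega>) U = real_cond_exp M (F q) (indicator B) \<omega>"
    using K U unfolding regular_conditional_law_def B_def by auto
  have "\<exists>\<^sub>F \<omega> in ae_filter M. \<omega> \<in> A \<and> \<omega> \<in> B"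
  proof (rule ccontr)
    assume "\<not> ?thesis"
    then have null: "AE \<omega> in M. indicator A \<omega> * indicator B \<omega> = (0::real)"
      by (auto simp: not_frequently indicator_def elim!: eventually_mono)
    \<comment> \<open>If \<open>A\<close> and \<open>B\<close> met in a null set only, pulling out
      the \<open>F q\<close>-measurable factor \<open>indicator A\<close> would make the conditional
      probability of the ball vanish almost everywhere on \<open>A\<close>.\<close>
    have "AE \<omega> in M. real_cond_exp M (F q) (\<lambda>\<omega>. indicator A \<omega> * indicator B \<omega>) \<omega> =
        indicator A \<omega> * real_cond_exp M (F q) (indicator B) \<omega>"
      using A by (intro real_cond_exp_mult) (auto intro!: integrable_real_indicator simp: indicator_inter_arith[symmetric] emeasure_eq_measure)
    moreover have "AE \<omega> in M. real_cond_exp M (F q) (\<lambda>\<omega>. indicator A \<omega> * indicator B \<omega>) \<omega> =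
        real_cond_exp M (F q) (\<lambda>_. 0) \<omega>"
      using null by (intro real_cond_exp_cong) auto
    moreover have "AE \<omega> in M. real_cond_exp M (F q) (\<lambda>_. 0) \<omega> = 0"
      by (intro real_cond_exp_F_meas) auto
    ultimately have "AE \<omega> in M. \<not> (\<omega> \<in> A \<and> \<bar>S q \<omega> - \<phi> q\<bar> < e)"
      using KU supp AE_space
    proof eventually_elim
      case (elim \<omega>)
      show ?case
      proof
        assume *: "\<omega> \<in> A \<and> \<bar>S q \<omega> - \<phi> q\<bar> < e"
        \<comment> \<open>The centre is shifted so as to start at the actual price. Truncation at 0
          restores nonnegativity and, since \<open>\<phi>\<close> is nonnegative, does not increase
          the distance to \<open>\<phi>\<close>.\<close>
        define w where "w = restrict (\<lambda>t. max 0 (\<phi> t + (S q \<omega> - \<phi> q))) {q..1}"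
        have w: "w \<in> mspace (path_space q)"
          using \<phi>(1) unfolding in_mspace_path_space w_def
          by (auto intro!: continuous_intros simp: simp_implies_def cong: continuous_on_cong_simp)
        have "mdist (path_space q) v w \<le> \<bar>S q \<omega> - \<phi> q\<bar>"
            using q \<phi>(2) by (subst mdist_path_space_le[OF _ v w]) (auto simp: v_def w_def max_def)
        then have "w \<in> U" using v w * by (simp add: U_def)
        moreover have "w \<in> paths_from (S q \<omega>) q"
          using w q S_pos[of q \<omega>] elim(6) by (simp add: paths_from_def w_def)
        ultimately have "0 < emeasure (K \<omega>) U"
          using elim(5) openU by (auto simp: topological_support_def)
        moreover have "K \<omega> \<in> space (prob_algebra (borel_of_topology ?T))"
          using conjunct1[OF K[unfolded regular_conditional_law_def]] elim(6)
          by (intro measurable_space[of K "F q"]) (simp_all add: space_F)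
        then have "finite_measure (K \<omega>)"
          by (simp add: space_prob_algebra prob_space.axioms(1))
        ultimately have "0 < measure (K \<omega>) U"
          using finite_measure.emeasure_eq_measure[of "K \<omega>" U] by simp
        then show False using elim * by auto
      qed
    qed
    then show False using freq by (simp add: frequently_def)
  qed
  then show ?thesis
  proof (rule frequently_rev_mp, intro always_eventually allI impI)
    fix \<omega> assume "\<omega> \<in> A \<and> \<omega> \<in> B"
    moreover then have "\<omega> \<in> space M" "X \<omega> \<in> U" by (auto simp: B_def)
    ultimately show "\<omega> \<in> A \<and> (\<forall>t\<in>{q..1}. \<bar>S t \<omega> - \<phi> t\<bar> < e)"
      using dist_le[of \<omega> "mdist (path_space q) v (X \<omega>)"] by (auto simp: U_def intro: le_less_trans)
  qed
qed

end

text \<open>A countable union of null sets is null. This replaces a random parameter with countably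
  many values by a constant.\<close>

lemma frequently_countable_Bex:
  assumes "countable I" "\<exists>\<^sub>F \<omega> in ae_filter M. \<exists>i\<in>I. P i \<omega>"
  shows "\<exists>i\<in>I. \<exists>\<^sub>F \<omega> in ae_filter M. P i \<omega>"
  using assms(2) AE_ball_countable[OF assms(1), of "\<lambda>\<omega> i. \<not> P i \<omega>" M]
  by (auto simp: frequently_def)

section \<open>Steering the price from a stopping time\<close>

context cfs_market
begin

text \<open>Conditional full support speaks of deterministic times and paths, so all random data are
  rounded to rationals: \<open>y\<close> for the price at \<open>T\<close>, \<open>z\<close> for the
  target, \<open>e\<close> for the tolerance, and a time \<open>q\<close> so soon after
  \<open>T\<close> that the price has barely moved. One choice of constants keeps positive outer
  probability, and from \<open>q\<close> on the price follows a straight line from \<open>y\<close>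
  to \<open>z\<close>.\<close>

lemma frequently_steer:
  assumes T: "stopping_time F T" "\<And>\<omega>. \<omega> \<in> space M \<Longrightarrow> T \<omega> \<in> {0..1}"
    and P: "Measurable.pred (pre_sigma T) P"
    and Z: "Z \<in> borel_measurable (pre_sigma T)" and \<eta>: "\<eta> \<in> borel_measurable (pre_sigma T)"
    and pos: "\<And>\<omega>. \<omega> \<in> space M \<Longrightarrow> 0 \<le> Z \<omega>" "\<And>\<omega>. \<omega> \<in> space M \<Longrightarrow> 0 < \<eta> \<omega>"
    and freq: "\<exists>\<^sub>F \<omega> in ae_filter M. P \<omega> \<and> T \<omega> < 1"
  shows "\<exists>\<^sub>F \<omega> in ae_filter M. P \<omega> \<and> T \<omega> < 1 \<and>
    (\<forall>t\<in>{T \<omega>..1}. S t \<omega> \<in> {min (S (T \<omega>) \<omega>) (Z \<omega>) - \<eta> \<omega> .. max (S (T \<omega>) \<omega>) (Z \<omega>) + \<eta> \<omega>}) \<and>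
    \<bar>S 1 \<omega> - Z \<omega>\<bar> \<le> \<eta> \<omega>"
proof -
  define R where "R = {(y, z, e, q). y \<in> \<rat> \<and> z \<in> \<rat> \<and> e \<in> \<rat> \<and> q \<in> \<rat> \<and>
    (0::real) < y \<and> (0::real) \<le> z \<and> (0::real) < e \<and> (0::real) \<le> q \<and> q < 1}"
  \<comment> \<open>Error budget: following the line costs \<open>2 * e\<close> and rounding its end
    points costs \<open>e\<close>, which together stay below \<open>\<eta>\<close>. Prices between
    \<open>T\<close> and \<open>q\<close> are tested at rational times only, so that the event is
    measurable at \<open>q\<close>.\<close>
  define Q where "Q = (\<lambda>(y, z, e, q) \<omega>. \<omega> \<in> space M \<and> P \<omega> \<and> T \<omega> < q \<and> \<bar>S (T \<omega>) \<omega> - y\<bar> < e \<and>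
    \<bar>Z \<omega> - z\<bar> < e \<and> 4 * e < \<eta> \<omega> \<and> (\<forall>t\<in>\<rat> \<inter> {0..q}. T \<omega> \<le> t \<longrightarrow> \<bar>S t \<omega> - y\<bar> \<le> e))"
  have countable: "countable R"
    by (rule countable_subset[of _ "\<rat> \<times> \<rat> \<times> \<rat> \<times> \<rat>"]) (auto simp: R_def countable_rat)
  have ex: "\<exists>i\<in>R. Q i \<omega>" if \<omega>: "\<omega> \<in> space M" "P \<omega>" "T \<omega> < 1" for \<omega>
  proof -
    let ?s = "S (T \<omega>) \<omega>"
    obtain e where e: "e \<in> \<rat>" "0 < e" "e < \<eta> \<omega> / 4"
      using Rats_dense_in_real[of 0 "\<eta> \<omega> / 4"] pos(2)[OF \<omega>(1)] by auto
    obtain y where y: "y \<in> \<rat>" "?s < y" "y < ?s + e"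
      using Rats_dense_in_real[of ?s "?s + e"] e by auto
    obtain z where z: "z \<in> \<rat>" "Z \<omega> < z" "z < Z \<omega> + e"
      using Rats_dense_in_real[of "Z \<omega>" "Z \<omega> + e"] e by auto
    have "((\<lambda>t. \<bar>S t \<omega> - y\<bar>) \<longlongrightarrow> \<bar>?s - y\<bar>) (at (T \<omega>) within {0..1})"
      using S_cont[OF \<omega>(1)] T(2)[OF \<omega>(1)] by (auto simp: continuous_on_def intro!: tendsto_intros)
    then have "\<forall>\<^sub>F t in at (T \<omega>) within {0..1}. \<bar>S t \<omega> - y\<bar> < e"
      by (rule order_tendstoD) (use y in auto)
    then obtain \<delta> where \<delta>: "0 < \<delta>"
      "\<And>t. t \<in> {0..1} \<Longrightarrow> t \<noteq> T \<omega> \<Longrightarrow> dist t (T \<omega>) < \<delta> \<Longrightarrow> \<bar>S t \<omega> - y\<bar> < e"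
      by (auto simp: eventually_at)
    obtain q where q: "q \<in> \<rat>" "T \<omega> < q" "q < min 1 (T \<omega> + \<delta>)"
      using Rats_dense_in_real[of "T \<omega>" "min 1 (T \<omega> + \<delta>)"] \<omega>(3) \<delta>(1) by auto
    have "\<bar>S t \<omega> - y\<bar> \<le> e" if "t \<in> {0..q}" "T \<omega> \<le> t" for t
      using \<delta>(2)[of t] y q that by (cases "t = T \<omega>") (auto simp: dist_real_def)
    moreover have "0 \<le> T \<omega>" "0 < ?s"
      using T(2)[OF \<omega>(1)] S_pos[OF _ \<omega>(1)] by auto
    ultimately have "(y, z, e, q) \<in> R" "Q (y, z, e, q) \<omega>"
      using e y z q \<omega> pos(1)[OF \<omega>(1)] by (auto simp: R_def Q_def)
    then show ?thesis by blast
  qed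
  have "\<exists>\<^sub>F \<omega> in ae_filter M. \<exists>i\<in>R. Q i \<omega>"
    using frequently_eventually_frequently[OF freq AE_space] by (rule frequently_elim1) (use ex in blast)
  from frequently_countable_Bex[OF countable this] obtain y z e q where
    R: "(y, z, e, q) \<in> R" and Q: "\<exists>\<^sub>F \<omega> in ae_filter M. Q (y, z, e, q) \<omega>" by auto
  from R have yzeq: "0 < y" "0 \<le> z" "0 < e" "0 \<le> q" "q < 1" "q \<in> \<rat>" by (auto simp: R_def)
  define A where "A = {\<omega> \<in> space M. Q (y, z, e, q) \<omega>}"
  note [measurable] = borel_measurable_S_stopping_time[OF T] P Z \<eta> measurable_stopping_time_pre_sigma[OF T(1)]
  have "A \<in> sets (F q)"
  proof -
    \<comment> \<open>\<open>A'\<close> collects everything decided at \<open>T\<close>; an event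
      prior to \<open>T\<close>, intersected with \<open>{T \<le> q}\<close>, lies in
      \<open>F q\<close>.\<close>
    define A' where "A' = {\<omega> \<in> space (pre_sigma T). P \<omega> \<and> T \<omega> < q \<and> \<bar>S (T \<omega>) \<omega> - y\<bar> < e \<and>
      \<bar>Z \<omega> - z\<bar> < e \<and> 4 * e < \<eta> \<omega>}"
    have "A' \<in> sets (pre_sigma T)" unfolding A'_def by measurable
    then have "{\<omega> \<in> A'. T \<omega> \<le> q} \<in> sets (F q)" by (rule sets_pre_sigmaD[OF T(1)])
    moreover have "Measurable.pred (F q) (\<lambda>\<omega>. \<forall>t\<in>\<rat> \<inter> {0..q}. T \<omega> \<le> t \<longrightarrow> \<bar>S t \<omega> - y\<bar> \<le> e)"
    proof (intro measurable_pred_countable ballI countable_Int1 countable_rat)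
      fix t assume t: "t \<in> \<rat> \<inter> {0..q}"
      then have [measurable]: "S t \<in> borel_measurable (F q)"
        using yzeq by (intro borel_measurable_S_F) auto
      have [measurable]: "Measurable.pred (F q) (\<lambda>\<omega>. T \<omega> \<le> t)"
        using t by (intro stopping_time_le_const[OF T(1)]) auto
      show "Measurable.pred (F q) (\<lambda>\<omega>. T \<omega> \<le> t \<longrightarrow> \<bar>S t \<omega> - y\<bar> \<le> e)" by measurable
    qed
    moreover have A_eq: "A = {\<omega> \<in> A'. T \<omega> \<le> q} \<inter>
        {\<omega> \<in> space (F q). \<forall>t\<in>\<rat> \<inter> {0..q}. T \<omega> \<le> t \<longrightarrow> \<bar>S t \<omega> - y\<bar> \<le> e}"
      by (auto simp: A_def A'_def Q_def space_F space_pre_sigma)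
    ultimately show ?thesis unfolding A_eq pred_def by (intro sets.Int)
  qed
  define \<phi> where "\<phi> = (\<lambda>t. y + (t - q) / (1 - q) * (z - y))"
  have \<phi>_bounds: "\<phi> t \<in> {min y z .. max y z}" if "t \<in> {q..1}" for t
  proof -
    define c where "c = (t - q) / (1 - q)"
    have c: "0 \<le> c" "c \<le> 1" using that yzeq by (auto simp: c_def field_simps)
    have "\<phi> t = y + c * (z - y)" by (simp add: \<phi>_def c_def)
    then have "\<phi> t = (1 - c) * y + c * z" by (simp add: algebra_simps)
    moreover have "(1 - c) * y + c * z \<le> max y z" "min y z \<le> (1 - c) * y + c * z"
      using mult_left_mono[OF max.cobounded1[of y z], of "1 - c"] mult_left_mono[OF max.cobounded2[of z y], of c]
        mult_left_mono[OF min.cobounded1[of y z], of "1 - c"] mult_left_mono[OF min.cobounded2[of y z], of c] c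
      by (simp_all add: algebra_simps)
    ultimately show ?thesis by auto
  qed
  have "\<exists>\<^sub>F \<omega> in ae_filter M. \<omega> \<in> A \<and> (\<forall>t\<in>{q..1}. \<bar>S t \<omega> - \<phi> t\<bar> < 2 * e)"
  proof (rule frequently_near_path)
    show "continuous_on {q..1} \<phi>" using yzeq unfolding \<phi>_def by (auto intro!: continuous_intros)
    show "0 \<le> \<phi> t" if "t \<in> {q..1}" for t using \<phi>_bounds[OF that] yzeq by auto
    \<comment> \<open>At \<open>q\<close> only the non-strict bound \<open>e\<close> around
      \<open>y\<close> is known, whereas a strict bound is required; hence the radius
      \<open>2 * e\<close>.\<close>
    have near: "\<bar>S q \<omega> - \<phi> q\<bar> < 2 * e" if "\<omega> \<in> A" for \<omega>
    proof -
      have "\<bar>S q \<omega> - y\<bar> \<le> e" using that yzeq by (auto simp: A_def Q_def)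
      then show ?thesis using yzeq by (auto simp: \<phi>_def)
    qed
    show "\<exists>\<^sub>F \<omega> in ae_filter M. \<omega> \<in> A \<and> \<bar>S q \<omega> - \<phi> q\<bar> < 2 * e"
      by (rule frequently_elim1[OF Q]) (use near in \<open>auto simp: A_def Q_def\<close>)
  qed (use yzeq \<open>A \<in> sets (F q)\<close> in auto)
  then show ?thesis
  proof (rule frequently_elim1)
    fix \<omega> assume "\<omega> \<in> A \<and> (\<forall>t\<in>{q..1}. \<bar>S t \<omega> - \<phi> t\<bar> < 2 * e)"
    then have \<omega>: "\<omega> \<in> space M" "P \<omega>" "T \<omega> < q" "\<bar>S (T \<omega>) \<omega> - y\<bar> < e" "\<bar>Z \<omega> - z\<bar> < e" "4 * e < \<eta> \<omega>"
      and early: "\<And>t. t \<in> \<rat> \<Longrightarrow> 0 \<le> t \<Longrightarrow> t \<le> q \<Longrightarrow> T \<omega> \<le> t \<Longrightarrow> \<bar>S t \<omega> - y\<bar> \<le> e"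
      and late: "\<And>t. t \<in> {q..1} \<Longrightarrow> \<bar>S t \<omega> - \<phi> t\<bar> < 2 * e"
      by (auto simp: A_def Q_def)
    have T0: "0 \<le> T \<omega>" using T(2)[OF \<omega>(1)] by simp
    have "continuous_on {T \<omega>..q} (\<lambda>t. S t \<omega> - y)"
      using T0 yzeq by (intro continuous_intros continuous_on_subset[OF S_cont[OF \<omega>(1)]]) auto
    from continuous_abs_le_iff_rat[OF \<omega>(3) this, of e]
    have early': "\<bar>S t \<omega> - y\<bar> \<le> e" if "t \<in> {T \<omega>..q}" for t
      using early T0 that by auto
    have "S t \<omega> \<in> {min (S (T \<omega>) \<omega>) (Z \<omega>) - \<eta> \<omega> .. max (S (T \<omega>) \<omega>) (Z \<omega>) + \<eta> \<omega>}"
      if t: "t \<in> {T \<omega>..1}" for t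
    proof (cases "t \<le> q")
      case True
      then have "\<bar>S t \<omega> - y\<bar> \<le> e" using early' t by simp
      then show ?thesis using \<omega>(4-6) by auto
    next
      case False
      then have "\<bar>S t \<omega> - \<phi> t\<bar> < 2 * e" "min y z \<le> \<phi> t" "\<phi> t \<le> max y z"
        using late[of t] \<phi>_bounds[of t] t by auto
      moreover have "min (S (T \<omega>) \<omega>) (Z \<omega>) \<le> min y z + e" "max y z \<le> max (S (T \<omega>) \<omega>) (Z \<omega>) + e"
        using \<omega>(4,5) by (auto simp: min_def max_def)
      ultimately show ?thesis using \<omega>(6) yzeq unfolding atLeastAtMost_iff by linarith
    qed
    moreover have "\<bar>S 1 \<omega> - Z \<omega>\<bar> \<le> \<eta> \<omega>"
    proof -
      have "\<phi> 1 = z" using yzeq by (simp add: \<phi>_def)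
      then show ?thesis using late[of 1] \<omega>(5,6) yzeq by auto
    qed
    ultimately show "P \<omega> \<and> T \<omega> < 1 \<and>
      (\<forall>t\<in>{T \<omega>..1}. S t \<omega> \<in> {min (S (T \<omega>) \<omega>) (Z \<omega>) - \<eta> \<omega> .. max (S (T \<omega>) \<omega>) (Z \<omega>) + \<eta> \<omega>}) \<and>
      \<bar>S 1 \<omega> - Z \<omega>\<bar> \<le> \<eta> \<omega>"
      using \<omega>(2,3) yzeq by auto
  qed
qed

end

subsection \<open>Forcing the holder of a super-hedge to intervene\<close>

locale hedging = cfs_market M F S s0
  for M :: "'a measure" and F :: "real \<Rightarrow> 'a measure" and S :: "real \<Rightarrow> 'a \<Rightarrow> real" and s0 :: real +
  fixes \<kappa> x :: real and f :: "real \<Rightarrow> real" and \<tau> h :: "nat \<Rightarrow> 'a \<Rightarrow> real"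
  assumes \<kappa>_pos: "0 < \<kappa>"
    and hedge: "super_hedge M F S \<kappa> (\<lambda>\<omega>. f (S 1 \<omega>)) x \<tau> h"
begin

text \<open>The wealth right after the \<open>k\<close>-th intervention, its cost included. In contrast,
  \<^const>\<open>gains\<close> at the time of an intervention does not yet include its cost.\<close>

definition W :: "nat \<Rightarrow> 'a \<Rightarrow> real" where
  "W k \<omega> = x + (\<Sum>i<k. h i \<omega> * (S (\<tau> (Suc i) \<omega>) \<omega> - S (\<tau> i \<omega>) \<omega>)) - \<kappa> * real k"

lemma W_Suc: "W (Suc k) \<omega> = W k \<omega> + h k \<omega> * (S (\<tau> (Suc k) \<omega>) \<omega> - S (\<tau> k \<omega>) \<omega>) - \<kappa>"
  by (simp add: W_def algebra_simps)

lemma intervention_system: "intervention_system M F \<tau>"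
  and h_measurable: "h i \<in> borel_measurable (pre_sigma (\<tau> i))"
  using hedge by (auto simp: super_hedge_def admissible_def strategy_def)

lemma \<tau>_stopping: "stopping_time F (\<tau> i)"
  and \<tau>_0: "\<omega> \<in> space M \<Longrightarrow> \<tau> 0 \<omega> = 0"
  and \<tau>_le_1: "\<omega> \<in> space M \<Longrightarrow> \<tau> i \<omega> \<le> 1"
  and \<tau>_Suc_less: "\<omega> \<in> space M \<Longrightarrow> \<tau> i \<omega> < 1 \<Longrightarrow> \<tau> i \<omega> < \<tau> (Suc i) \<omega>"
  and \<tau>_le_Suc: "\<omega> \<in> space M \<Longrightarrow> \<tau> i \<omega> \<le> \<tau> (Suc i) \<omega>"
  using intervention_system by (auto simp: intervention_system_def)

lemma \<tau>_mono: "\<omega> \<in> space M \<Longrightarrow> i \<le> j \<Longrightarrow> \<tau> i \<omega> \<le> \<tau> j \<omega>"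
  using lift_Suc_mono_le[of "\<lambda>i. \<tau> i \<omega>"] \<tau>_le_Suc by blast

lemma \<tau>_range: "\<omega> \<in> space M \<Longrightarrow> \<tau> i \<omega> \<in> {0..1}"
  using \<tau>_mono[of \<omega> 0 i] \<tau>_0[of \<omega>] \<tau>_le_1[of \<omega> i] by auto

lemma measurable_pre_sigma_\<tau>_mono:
  assumes "i \<le> k" "g \<in> borel_measurable (pre_sigma (\<tau> i))"
  shows "g \<in> borel_measurable (pre_sigma (\<tau> k))"
proof -
  have "sets (pre_sigma (\<tau> i)) \<subseteq> sets (pre_sigma (\<tau> k))"
    using assms(1) by (intro mono_pre_sigma \<tau>_stopping \<tau>_mono)
  then show ?thesis
    using assms(2) measurable_mono[of borel borel "pre_sigma (\<tau> i)" "pre_sigma (\<tau> k)"]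
    by (auto simp: space_pre_sigma)
qed

lemma S_\<tau>_measurable: "(\<lambda>\<omega>. S (\<tau> i \<omega>) \<omega>) \<in> borel_measurable (pre_sigma (\<tau> i))"
  by (intro borel_measurable_S_stopping_time \<tau>_stopping \<tau>_range)

lemma W_measurable: "W k \<in> borel_measurable (pre_sigma (\<tau> k))"
proof -
  have "h i \<in> borel_measurable (pre_sigma (\<tau> k))"
    "(\<lambda>\<omega>. S (\<tau> i \<omega>) \<omega>) \<in> borel_measurable (pre_sigma (\<tau> k))" if "i \<le> k" for i
    using measurable_pre_sigma_\<tau>_mono[OF that] h_measurable S_\<tau>_measurable by auto
  then show ?thesis unfolding W_def[abs_def]
    by (intro borel_measurable_diff borel_measurable_add borel_measurable_sum borel_measurable_times) auto
qed

text \<open>Costs count interventions strictly before \<open>t\<close>, so exactly \<open>k\<close>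
  are paid on this half-open interval, the trade at time 0 being free. Including the right end
  allows evaluation at the next intervention itself.\<close>

lemma gains_eq:
  assumes \<omega>: "\<omega> \<in> space M" and t: "\<tau> k \<omega> < t" "t \<le> \<tau> (Suc k) \<omega>"
  shows "x + gains \<kappa> S \<tau> h t \<omega> = W k \<omega> + h k \<omega> * (S t \<omega> - S (\<tau> k \<omega>) \<omega>)"
proof -
  have before: "\<tau> i \<omega> < t" if "i \<le> k" for i
    using \<tau>_mono[OF \<omega> that] t by linarith
  have after: "t \<le> \<tau> i \<omega>" if "Suc k \<le> i" for i
    using \<tau>_mono[OF \<omega> that] t by linarith
  have "{i. \<tau> i \<omega> < t} = {..k}"
    using before after by (auto simp: not_less_eq_eq[symmetric] intro: leI dest: leD)
  then have last: "last_intervention_before \<tau> t \<omega> = enat k"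
    unfolding last_intervention_before_def by (auto intro!: antisym SUP_least SUP_upper)
  let ?g = "\<lambda>i. h i \<omega> * (S (min (\<tau> (Suc i) \<omega>) t) \<omega> - S (min (\<tau> i \<omega>) t) \<omega>)"
  have "(\<Sum>i. ?g i) = (\<Sum>i\<in>{..<Suc k}. ?g i)"
    by (rule suminf_finite) (auto simp: min_absorb2 after)
  also have "\<dots> = (\<Sum>i<k. ?g i) + ?g k" by simp
  also have "(\<Sum>i<k. ?g i) = (\<Sum>i<k. h i \<omega> * (S (\<tau> (Suc i) \<omega>) \<omega> - S (\<tau> i \<omega>) \<omega>))"
    by (intro sum.cong) (auto simp: min_absorb1 before less_imp_le)
  also have "?g k = h k \<omega> * (S t \<omega> - S (\<tau> k \<omega>) \<omega>)"
    using t by (simp add: min_absorb1 min_absorb2)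
  finally show ?thesis by (simp add: gains_def last W_def)
qed

text \<open>One move of the adversary: the price is steered from \<open>\<tau> k\<close> towards
  \<open>Z\<close>. Without another intervention before time 1 the terminal wealth would be the left
  side of \<open>lose\<close>, contradicting the super-hedge. So the trader intervenes while the
  price is inside the corridor, and \<open>progress\<close> yields \<open>Q\<close>.\<close>

lemma frequently_forced_intervention:
  assumes P: "Measurable.pred (pre_sigma (\<tau> k)) P"
    and Z: "Z \<in> borel_measurable (pre_sigma (\<tau> k))" and \<eta>: "\<eta> \<in> borel_measurable (pre_sigma (\<tau> k))"
    and pos: "\<And>\<omega>. \<omega> \<in> space M \<Longrightarrow> 0 \<le> Z \<omega>" "\<And>\<omega>. \<omega> \<in> space M \<Longrightarrow> 0 < \<eta> \<omega>"
    and freq: "\<exists>\<^sub>F \<omega> in ae_filter M. P \<omega> \<and> \<tau> k \<omega> < 1"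
    and lose: "\<And>\<omega> u. \<omega> \<in> space M \<Longrightarrow> P \<omega> \<Longrightarrow> 0 < u \<Longrightarrow> \<bar>u - Z \<omega>\<bar> \<le> \<eta> \<omega> \<Longrightarrow>
      W k \<omega> + h k \<omega> * (u - S (\<tau> k \<omega>) \<omega>) < f u"
    and progress: "\<And>\<omega>. \<omega> \<in> space M \<Longrightarrow> P \<omega> \<Longrightarrow>
      S (\<tau> (Suc k) \<omega>) \<omega> \<in> {min (S (\<tau> k \<omega>) \<omega>) (Z \<omega>) - \<eta> \<omega> .. max (S (\<tau> k \<omega>) \<omega>) (Z \<omega>) + \<eta> \<omega>} \<Longrightarrow> Q \<omega>"
  shows "\<exists>\<^sub>F \<omega> in ae_filter M. Q \<omega> \<and> \<tau> (Suc k) \<omega> < 1"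
proof -
  have "AE \<omega> in M. f (S 1 \<omega>) \<le> x + gains \<kappa> S \<tau> h 1 \<omega>"
    using hedge by (simp add: super_hedge_def)
  then have ev: "AE \<omega> in M. \<omega> \<in> space M \<and> f (S 1 \<omega>) \<le> x + gains \<kappa> S \<tau> h 1 \<omega>"
    by (auto elim: eventually_mono intro: AE_conjI)
  show ?thesis
    using frequently_eventually_frequently[OF
        frequently_steer[OF \<tau>_stopping \<tau>_range P Z \<eta> pos freq] ev]
  proof (rule frequently_elim1)
    fix \<omega>
    let ?I = "{min (S (\<tau> k \<omega>) \<omega>) (Z \<omega>) - \<eta> \<omega> .. max (S (\<tau> k \<omega>) \<omega>) (Z \<omega>) + \<eta> \<omega>}"
    assume "(P \<omega> \<and> \<tau> k \<omega> < 1 \<and> (\<forall>t\<in>{\<tau> k \<omega>..1}. S t \<omega> \<in> ?I) \<and> \<bar>S 1 \<omega> - Z \<omega>\<bar> \<le> \<eta> \<omega>) \<and>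
      \<omega> \<in> space M \<and> f (S 1 \<omega>) \<le> x + gains \<kappa> S \<tau> h 1 \<omega>"
    then have \<omega>: "P \<omega>" "\<tau> k \<omega> < 1" "\<bar>S 1 \<omega> - Z \<omega>\<bar> \<le> \<eta> \<omega>" "\<omega> \<in> space M"
      "f (S 1 \<omega>) \<le> x + gains \<kappa> S \<tau> h 1 \<omega>" and I: "\<And>t. t \<in> {\<tau> k \<omega>..1} \<Longrightarrow> S t \<omega> \<in> ?I"
      by blast+
    have "\<not> 1 \<le> \<tau> (Suc k) \<omega>"
    proof
      assume "1 \<le> \<tau> (Suc k) \<omega>"
      then have "f (S 1 \<omega>) \<le> W k \<omega> + h k \<omega> * (S 1 \<omega> - S (\<tau> k \<omega>) \<omega>)"
        using gains_eq[OF \<omega>(4,2)] \<omega>(5) by simp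
      moreover have "0 < S 1 \<omega>" using S_pos \<omega>(4) by simp
      ultimately show False using lose[OF \<omega>(4,1) _ \<omega>(3)] by force
    qed
    moreover have "S (\<tau> (Suc k) \<omega>) \<omega> \<in> ?I"
      using \<tau>_le_1 \<tau>_le_Suc \<omega>(4) by (intro I) auto
    ultimately show "Q \<omega> \<and> \<tau> (Suc k) \<omega> < 1" using progress[OF \<omega>(4,1)] by simp
  qed
qed

text \<open>Admissibility is applied at the intervention time. The gains there do not yet contain
  the cost of that intervention, hence the extra \<open>\<kappa>\<close>; \<open>min c 0\<close>
  covers \<open>k = 0\<close>, where the wealth is \<open>x\<close>.\<close>

lemma AE_W_bounded_below: "\<exists>c. AE \<omega> in M. \<forall>k. \<tau> k \<omega> < 1 \<longrightarrow> c \<le> W k \<omega>"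
proof -
  obtain c where c: "AE \<omega> in M. \<forall>t\<in>{0..1}. c \<le> gains \<kappa> S \<tau> h t \<omega>"
    using hedge by (auto simp: super_hedge_def admissible_def)
  have "AE \<omega> in M. \<forall>k. \<tau> k \<omega> < 1 \<longrightarrow> x + min c 0 - \<kappa> \<le> W k \<omega>"
    using c AE_space
  proof (eventually_elim, intro allI impI)
    fix \<omega> k assume c: "\<forall>t\<in>{0..1}. c \<le> gains \<kappa> S \<tau> h t \<omega>" and \<omega>: "\<omega> \<in> space M" and "\<tau> k \<omega> < 1"
    show "x + min c 0 - \<kappa> \<le> W k \<omega>"
    proof (cases k)
      case 0 then show ?thesis using \<kappa>_pos by (simp add: W_def)
    next
      case (Suc m)
      then have "\<tau> m \<omega> < 1" using \<tau>_le_Suc[OF \<omega>, of m] \<open>\<tau> k \<omega> < 1\<close> by simp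
      then have "x + gains \<kappa> S \<tau> h (\<tau> k \<omega>) \<omega> = W k \<omega> + \<kappa>"
        using gains_eq[OF \<omega> \<tau>_Suc_less[OF \<omega>]] Suc by (simp add: W_Suc)
      moreover have "c \<le> gains \<kappa> S \<tau> h (\<tau> k \<omega>) \<omega>" using c \<tau>_range[OF \<omega>] by blast
      ultimately show ?thesis by linarith
    qed
  qed
  then show ?thesis by blast
qed

end

text \<open>Chooses a price tolerance so small that a holding \<open>a\<close> earns at most
  \<open>b\<close>; the summand 1 avoids division by zero.\<close>

lemma abs_mult_le_of_abs_le_divide:
  fixes a b v :: real
  assumes "\<bar>v\<bar> \<le> b / (\<bar>a\<bar> + 1)"
  shows "\<bar>a * v\<bar> \<le> b"
proof -
  have "\<bar>a * v\<bar> \<le> (\<bar>a\<bar> + 1) * \<bar>v\<bar>" by (simp add: abs_mult mult_right_mono)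
  also have "\<dots> \<le> b" using assms by (simp add: pos_le_divide_eq mult.commute)
  finally show ?thesis .
qed

section \<open>The two phases of the adversary: building a deficit, then freezing the price\<close>

context hedging
begin

text \<open>From one intervention to the next, \<open>W - d * S\<close> changes by
  \<open>h - d\<close> times the price move, minus \<open>\<kappa>\<close>. Steering keeps the first
  term at most \<open>\<kappa> / 2\<close>, so each forced intervention lowers the quantity by at
  least \<open>\<kappa> / 2\<close>. Of the initial gap \<open>\<delta>\<close>, one half is kept to
  absorb approximation errors near price 0.\<close>

lemma frequently_large_deficit:
  assumes supp: "\<And>y. 0 \<le> y \<Longrightarrow> d * y - C \<le> f y" and cont: "continuous_on {0..} f"
    and \<delta>: "0 < \<delta>" and x: "x = f 0 + s0 * d - \<delta>"
  shows "\<exists>\<^sub>F \<omega> in ae_filter M.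
    W k \<omega> - d * S (\<tau> k \<omega>) \<omega> < f 0 - \<delta> / 2 - \<kappa> / 2 * real k \<and> \<tau> k \<omega> < 1"
proof (induction k)
  case 0
  have "AE \<omega> in M. W 0 \<omega> - d * S (\<tau> 0 \<omega>) \<omega> < f 0 - \<delta> / 2 - \<kappa> / 2 * real 0 \<and> \<tau> 0 \<omega> < 1"
    using AE_space
  proof eventually_elim
    case (elim \<omega>)
    then have "W 0 \<omega> - d * S (\<tau> 0 \<omega>) \<omega> = x - d * s0" by (simp add: W_def \<tau>_0 S_0)
    also have "\<dots> < f 0 - \<delta> / 2" using \<delta> x by (simp add: mult.commute)
    finally show ?case using elim by (simp add: \<tau>_0)
  qed
  then show ?case
    using eventually_frequently[OF ae_filter_bot] by blast
next
  case (Suc k)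
  have "(f \<longlongrightarrow> f 0) (at 0 within {0..})" using cont by (auto simp: continuous_on_def)
  then have "\<forall>\<^sub>F u in at 0 within {0..}. f 0 - \<delta> / 4 < f u"
    by (rule order_tendstoD) (use \<delta> in simp)
  then obtain u0 where u0: "0 < u0" "\<And>u. 0 < u \<Longrightarrow> u < u0 \<Longrightarrow> f 0 - \<delta> / 4 < f u"
    unfolding eventually_at by (auto simp: dist_real_def)
  \<comment> \<open>For a holding below \<open>d\<close> the target is so high that
    \<open>u * (d - h)\<close> exceeds \<open>W - h * S + C\<close>, which puts the wealth below
    \<open>d * u - C\<close>. The summand 1 absorbs the steering error, and the absolute price
    places the target above the current price.\<close>
  define Z where "Z = (\<lambda>\<omega>. if d \<le> h k \<omega> then 0 else
    1 + \<bar>S (\<tau> k \<omega>) \<omega>\<bar> + (\<bar>W k \<omega> - h k \<omega> * S (\<tau> k \<omega>) \<omega> + C\<bar> + 1) / (d - h k \<omega>))"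
  \<comment> \<open>In order: the error absorbed by \<open>Z\<close>; closeness to 0, where
    \<open>f\<close> exceeds \<open>f 0 - \<delta> / 4\<close>; gains of \<open>W - d * S\<close> of
    at most \<open>\<kappa> / 2\<close>; and a value \<open>h * u\<close> of at most
    \<open>\<delta> / 4\<close> near price 0.\<close>
  define \<eta> where "\<eta> = (\<lambda>\<omega>. min (min 1 (u0 / 2))
    (min (\<kappa> / 2 / (\<bar>h k \<omega> - d\<bar> + 1)) (\<delta> / 4 / (\<bar>h k \<omega>\<bar> + 1))))"
  note [measurable] = W_measurable[of k] h_measurable[of k] S_\<tau>_measurable[of k]
  show ?case
  proof (rule frequently_forced_intervention[OF _ _ _ _ _ Suc.IH])
    show "Z \<in> borel_measurable (pre_sigma (\<tau> k))" unfolding Z_def by measurable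
    show "\<eta> \<in> borel_measurable (pre_sigma (\<tau> k))" unfolding \<eta>_def by measurable
    show "Measurable.pred (pre_sigma (\<tau> k))
      (\<lambda>\<omega>. W k \<omega> - d * S (\<tau> k \<omega>) \<omega> < f 0 - \<delta> / 2 - \<kappa> / 2 * real k)" by measurable
    fix \<omega> assume \<omega>: "\<omega> \<in> space M"
    let ?s = "S (\<tau> k \<omega>) \<omega>" and ?s' = "S (\<tau> (Suc k) \<omega>) \<omega>" and ?h = "h k \<omega>"
    show "0 \<le> Z \<omega>" by (auto simp: Z_def)
    show "0 < \<eta> \<omega>" using u0 \<kappa>_pos \<delta> by (auto simp: \<eta>_def intro!: divide_pos_pos add_nonneg_pos)
    have s_pos: "0 < ?s" using S_pos \<tau>_range \<omega> by blast
    assume P: "W k \<omega> - d * ?s < f 0 - \<delta> / 2 - \<kappa> / 2 * real k"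
    {
      fix u assume u: "0 < u" "\<bar>u - Z \<omega>\<bar> \<le> \<eta> \<omega>"
      show "W k \<omega> + ?h * (u - ?s) < f u"
      proof (cases "d \<le> ?h")
        case True
        have "\<bar>u\<bar> \<le> \<delta> / 4 / (\<bar>?h\<bar> + 1)" "u < u0" using True u u0 by (auto simp: Z_def \<eta>_def)
        then have "?h * u \<le> \<delta> / 4" "f 0 - \<delta> / 4 < f u"
          using abs_mult_le_of_abs_le_divide[of u "\<delta> / 4" ?h] u0 u by auto
        moreover have "d * ?s \<le> ?h * ?s" using True s_pos by simp
        moreover have "0 \<le> \<kappa> / 2 * real k" using \<kappa>_pos by simp
        ultimately show ?thesis using P by (simp add: right_diff_distrib)
      next
        case False
        have "\<eta> \<omega> \<le> 1" by (simp add: \<eta>_def min.coboundedI1)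
        then have "\<bar>?s\<bar> + (\<bar>W k \<omega> - ?h * ?s + C\<bar> + 1) / (d - ?h) \<le> u"
          using u False unfolding Z_def by simp
        then have "(\<bar>W k \<omega> - ?h * ?s + C\<bar> + 1) / (d - ?h) \<le> u" by linarith
        then have "\<bar>W k \<omega> - ?h * ?s + C\<bar> + 1 \<le> u * (d - ?h)"
          using False by (simp add: pos_divide_le_eq)
        then show ?thesis using supp[of u] u by (simp add: algebra_simps)
      qed
    next
      assume I: "?s' \<in> {min ?s (Z \<omega>) - \<eta> \<omega> .. max ?s (Z \<omega>) + \<eta> \<omega>}"
      have bound: "\<bar>(?h - d) * \<eta> \<omega>\<bar> \<le> \<kappa> / 2"
        using \<open>0 < \<eta> \<omega>\<close> by (intro abs_mult_le_of_abs_le_divide) (auto simp: \<eta>_def)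
      \<comment> \<open>In the direction favourable to \<open>h - d\<close> the price moves by at
        most \<open>\<eta>\<close>, since the corridor extends beyond the current price only by
        \<open>\<eta>\<close> on that side.\<close>
      have "(?h - d) * (?s' - ?s) \<le> \<kappa> / 2"
      proof (cases "d \<le> ?h")
        case True
        then have "?s' - ?s \<le> \<eta> \<omega>" using I s_pos by (auto simp: Z_def)
        then have "(?h - d) * (?s' - ?s) \<le> (?h - d) * \<eta> \<omega>" using True by (intro mult_left_mono) auto
        then show ?thesis using bound by linarith
      next
        case False
        then have "0 \<le> (\<bar>W k \<omega> - ?h * ?s + C\<bar> + 1) / (d - ?h)" by (intro divide_nonneg_pos) auto
        moreover have "Z \<omega> = 1 + \<bar>?s\<bar> + (\<bar>W k \<omega> - ?h * ?s + C\<bar> + 1) / (d - ?h)"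
          using False by (simp add: Z_def)
        ultimately have "?s \<le> Z \<omega>" by linarith
        then have "- \<eta> \<omega> \<le> ?s' - ?s" using I by auto
        then have "(?h - d) * (?s' - ?s) \<le> (?h - d) * (- \<eta> \<omega>)"
          using False by (intro mult_left_mono_neg) auto
        then show ?thesis using bound by linarith
      qed
      then show "W (Suc k) \<omega> - d * ?s' < f 0 - \<delta> / 2 - \<kappa> / 2 * real (Suc k)"
        using P unfolding W_Suc by (simp add: algebra_simps add_divide_distrib)
    }
  qed
qed

text \<open>The first phase bounds \<open>W - d * S\<close> but not \<open>W\<close>, since the
  price may have risen far. With the price frozen, the margin 1 keeps the wealth below the payoff,
  which forces further interventions. Each costs \<open>\<kappa>\<close> while the tiny price moves
  earn at most \<open>\<kappa> / 2\<close>, so \<open>W\<close> falls without bound, against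
  admissibility.\<close>

lemma no_deficit_below_affine_minorant:
  assumes supp: "\<And>y. 0 \<le> y \<Longrightarrow> d * y - C \<le> f y"
  shows "AE \<omega> in M. \<not> (W n \<omega> - d * S (\<tau> n \<omega>) \<omega> < - C - 1 \<and> \<tau> n \<omega> < 1)"
proof (rule ccontr)
  assume "\<not> ?thesis"
  then have "\<exists>\<^sub>F \<omega> in ae_filter M. W n \<omega> - d * S (\<tau> n \<omega>) \<omega> < - C - 1 \<and> \<tau> n \<omega> < 1"
    by (simp add: frequently_def)
  then have "\<exists>\<^sub>F \<omega> in ae_filter M. \<exists>m\<in>(UNIV :: nat set).
      (W n \<omega> - d * S (\<tau> n \<omega>) \<omega> < - C - 1 \<and> W n \<omega> < real m) \<and> \<tau> n \<omega> < 1"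
    by (rule frequently_elim1) (use reals_Archimedean2 in auto)
  \<comment> \<open>\<open>W n\<close> need not have a deterministic upper bound; fixing
    \<open>m\<close> supplies the level from which the decrease is counted.\<close>
  from frequently_countable_Bex[OF _ this] obtain m :: nat where
    m: "\<exists>\<^sub>F \<omega> in ae_filter M. (W n \<omega> - d * S (\<tau> n \<omega>) \<omega> < - C - 1 \<and> W n \<omega> < real m) \<and> \<tau> n \<omega> < 1"
    by auto
  have freeze: "\<exists>\<^sub>F \<omega> in ae_filter M. (W (n + j) \<omega> - d * S (\<tau> (n + j) \<omega>) \<omega> < - C - 1 \<and>
      W (n + j) \<omega> < real m - \<kappa> / 2 * real j) \<and> \<tau> (n + j) \<omega> < 1" for j
  proof (induction j)
    case 0 then show ?case using m by simp
  next
    case (Suc j)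
    let ?k = "n + j"
    \<comment> \<open>The first bound keeps the hedge failing at time 1, the second preserves the
      deficit of \<open>W - d * S\<close>, and the third makes \<open>W\<close> itself
      decrease.\<close>
    define \<eta> where "\<eta> = (\<lambda>\<omega>. min (1 / (\<bar>h ?k \<omega> - d\<bar> + 1))
      (min (\<kappa> / 2 / (\<bar>h ?k \<omega> - d\<bar> + 1)) (\<kappa> / 2 / (\<bar>h ?k \<omega>\<bar> + 1))))"
    note [measurable] = W_measurable[of ?k] h_measurable[of ?k] S_\<tau>_measurable[of ?k]
    show ?case unfolding add_Suc_right
    proof (rule frequently_forced_intervention[OF _ _ _ _ _ Suc.IH])
      show "(\<lambda>\<omega>. S (\<tau> ?k \<omega>) \<omega>) \<in> borel_measurable (pre_sigma (\<tau> ?k))" by measurable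
      show "\<eta> \<in> borel_measurable (pre_sigma (\<tau> ?k))" unfolding \<eta>_def by measurable
      show "Measurable.pred (pre_sigma (\<tau> ?k)) (\<lambda>\<omega>. W ?k \<omega> - d * S (\<tau> ?k \<omega>) \<omega> < - C - 1 \<and>
        W ?k \<omega> < real m - \<kappa> / 2 * real j)" by measurable
      fix \<omega> assume \<omega>: "\<omega> \<in> space M"
      let ?s = "S (\<tau> ?k \<omega>) \<omega>" and ?s' = "S (\<tau> (Suc ?k) \<omega>) \<omega>" and ?h = "h ?k \<omega>"
      show "0 \<le> ?s" using S_pos \<tau>_range \<omega> less_imp_le by blast
      show "0 < \<eta> \<omega>" using \<kappa>_pos by (auto simp: \<eta>_def intro!: divide_pos_pos add_nonneg_pos)
      assume P: "W ?k \<omega> - d * ?s < - C - 1 \<and> W ?k \<omega> < real m - \<kappa> / 2 * real j"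
      {
        fix u assume u: "0 < u" "\<bar>u - ?s\<bar> \<le> \<eta> \<omega>"
        have "\<bar>(?h - d) * (u - ?s)\<bar> \<le> 1"
          using u by (intro abs_mult_le_of_abs_le_divide) (auto simp: \<eta>_def)
        then have "(?h - d) * (u - ?s) \<le> 1" by linarith
        then show "W ?k \<omega> + ?h * (u - ?s) < f u"
          using P supp[of u] u by (simp add: algebra_simps)
      next
        assume "?s' \<in> {min ?s ?s - \<eta> \<omega> .. max ?s ?s + \<eta> \<omega>}"
        then have "\<bar>?s' - ?s\<bar> \<le> \<eta> \<omega>" by auto
        then have "\<bar>(?h - d) * (?s' - ?s)\<bar> \<le> \<kappa> / 2" "\<bar>?h * (?s' - ?s)\<bar> \<le> \<kappa> / 2"
          by (intro abs_mult_le_of_abs_le_divide, simp add: \<eta>_def)+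
        then have "(?h - d) * (?s' - ?s) \<le> \<kappa> / 2" "?h * (?s' - ?s) \<le> \<kappa> / 2" by linarith+
        then show "W (Suc ?k) \<omega> - d * ?s' < - C - 1 \<and> W (Suc ?k) \<omega> < real m - \<kappa> / 2 * real (Suc j)"
          using P \<kappa>_pos unfolding W_Suc by (simp add: algebra_simps add_divide_distrib)
      }
    qed
  qed
  obtain c where c: "AE \<omega> in M. \<forall>k. \<tau> k \<omega> < 1 \<longrightarrow> c \<le> W k \<omega>"
    using AE_W_bounded_below by blast
  obtain j where "real m - c < real j * (\<kappa> / 2)"
    using reals_Archimedean3[of "\<kappa> / 2"] half_gt_zero[OF \<kappa>_pos] by blast
  moreover obtain \<omega> where "W (n + j) \<omega> < real m - \<kappa> / 2 * real j" "c \<le> W (n + j) \<omega>"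
    using frequently_ex[OF frequently_eventually_frequently[OF freeze[of j] c]] by auto
  ultimately show False by (simp add: algebra_simps)
qed

text \<open>With less capital, \<open>n\<close> forced interventions with
  \<open>n * \<kappa> / 2\<close> above \<open>f 0 + C + 1\<close> create precisely the deficit that
  the second phase excludes.\<close>

lemma initial_capital_ge:
  assumes supp: "\<And>y. 0 \<le> y \<Longrightarrow> d * y - C \<le> f y" and cont: "continuous_on {0..} f"
  shows "f 0 + s0 * d \<le> x"
proof (rule ccontr)
  define \<delta> where "\<delta> = f 0 + s0 * d - x"
  assume "\<not> ?thesis"
  then have \<delta>: "0 < \<delta>" "x = f 0 + s0 * d - \<delta>" by (auto simp: \<delta>_def)
  obtain n where "f 0 + C + 1 < real n * (\<kappa> / 2)"
    using reals_Archimedean3[of "\<kappa> / 2"] half_gt_zero[OF \<kappa>_pos] by blast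
  then have "\<exists>\<^sub>F \<omega> in ae_filter M. W n \<omega> - d * S (\<tau> n \<omega>) \<omega> < - C - 1 \<and> \<tau> n \<omega> < 1"
    using \<delta> by (intro frequently_elim1[OF frequently_large_deficit[OF supp cont \<delta>, of n]])
      (auto simp: algebra_simps)
  then show False
    using no_deficit_below_affine_minorant[OF supp, of n] by (simp add: frequently_def)
qed

end

subsection \<open>Buying and holding\<close>

context cfs_market
begin

text \<open>The straight line from \<open>s0\<close> to \<open>z\<close> is followed closely with
  positive probability. A negative value at \<open>z\<close> would by continuity make the payoff
  negative there.\<close>

lemma payoff_nonneg:
  fixes f :: "real \<Rightarrow> real"
  assumes cont: "continuous_on {0..} f" and payoff: "\<And>\<omega>. \<omega> \<in> space M \<Longrightarrow> 0 \<le> f (S 1 \<omega>)"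
    and s0: "0 < s0" and z: "0 \<le> z"
  shows "0 \<le> f z"
proof (rule ccontr)
  assume "\<not> 0 \<le> f z"
  have "(f \<longlongrightarrow> f z) (at z within {0..})" using cont z by (auto simp: continuous_on_def)
  then have "\<forall>\<^sub>F u in at z within {0..}. f u < 0"
    by (rule order_tendstoD) (use \<open>\<not> 0 \<le> f z\<close> in simp)
  then obtain e where e: "0 < e" "\<And>u. 0 \<le> u \<Longrightarrow> u \<noteq> z \<Longrightarrow> \<bar>u - z\<bar> < e \<Longrightarrow> f u < 0"
    unfolding eventually_at by (auto simp: dist_real_def)
  have "\<exists>\<^sub>F \<omega> in ae_filter M. \<omega> \<in> space M \<and> (\<forall>t\<in>{0..1}. \<bar>S t \<omega> - (s0 + t * (z - s0))\<bar> < e)"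
  proof (rule frequently_near_path)
    show "space M \<in> sets (F 0)" using sets.top[of "F 0"] by (simp add: space_F)
    show "0 \<le> s0 + t * (z - s0)" if "t \<in> {0..1}" for t
    proof -
      have "s0 + t * (z - s0) = (1 - t) * s0 + t * z" by (simp add: algebra_simps)
      then show ?thesis using that s0 z by simp
    qed
    show "\<exists>\<^sub>F \<omega> in ae_filter M. \<omega> \<in> space M \<and> \<bar>S 0 \<omega> - (s0 + 0 * (z - s0))\<bar> < e"
      using AE_space e(1) by (intro eventually_frequently ae_filter_bot) (auto elim!: eventually_mono simp: S_0)
  qed (auto intro!: continuous_intros)
  then obtain \<omega> where \<omega>: "\<omega> \<in> space M" "\<forall>t\<in>{0..1}. \<bar>S t \<omega> - (s0 + t * (z - s0))\<bar> < e"
    using frequently_ex by blast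
  from \<omega>(2) have "\<bar>S 1 \<omega> - z\<bar> < e" by (auto dest: bspec[of _ _ 1])
  then have "f (S 1 \<omega>) < 0"
    using e(2)[of "S 1 \<omega>"] S_pos[of 1 \<omega>] \<omega>(1) \<open>\<not> 0 \<le> f z\<close> by (cases "S 1 \<omega> = z") auto
  then show False using payoff[OF \<omega>(1)] by simp
qed

text \<open>The gains are \<open>a * (S t - s0)\<close>. Admissibility uses
  \<open>0 \<le> a\<close>: positive prices then give the lower bound
  \<open>- a * s0\<close>.\<close>

lemma super_hedge_buy_and_hold:
  assumes a: "0 \<le> a" and dom: "\<And>y. 0 \<le> y \<Longrightarrow> f y \<le> f 0 + a * y"
  shows "super_hedge M F S \<kappa> (\<lambda>\<omega>. f (S 1 \<omega>)) (f 0 + s0 * a) no_later_interventions (initial_holding a)"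
proof -
  \<comment> \<open>All later times equal 1 and so are never strictly before \<open>t\<close>; no
    cost arises. At \<open>t = 0\<close> the supremum is over the empty set.\<close>
  have last: "last_intervention_before no_later_interventions t \<omega> = enat 0" if "t \<in> {0..1}"
    for t and \<omega> :: 'a
  proof -
    have "{i. no_later_interventions i \<omega> < t} \<subseteq> {0}"
      using that by (auto simp: no_later_interventions_def split: if_splits)
    then have "last_intervention_before no_later_interventions t \<omega> \<le> 0"
      unfolding last_intervention_before_def by (intro SUP_least) (auto simp: zero_enat_def)
    then show ?thesis by (simp add: zero_enat_def[symmetric])
  qed
  have gains: "gains \<kappa> S no_later_interventions (initial_holding a) t \<omega> = a * (S t \<omega> - s0)"
    if t: "t \<in> {0..1}" and \<omega>: "\<omega> \<in> space M" for t \<omega>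
  proof -
    let ?g = "\<lambda>i. initial_holding a i \<omega> * (S (min (no_later_interventions (Suc i) \<omega>) t) \<omega> -
      S (min (no_later_interventions i \<omega>) t) \<omega>)"
    have "(\<Sum>i. ?g i) = (\<Sum>i\<in>{0}. ?g i)"
      by (rule suminf_finite) (auto simp: initial_holding_def)
    also have "\<dots> = a * (S t \<omega> - s0)"
      using t S_0[OF \<omega>] by (simp add: initial_holding_def no_later_interventions_def min_absorb2 min_absorb1)
    finally show ?thesis using last[OF t] by (simp add: gains_def)
  qed
  have "strategy M F no_later_interventions (initial_holding a)"
    unfolding strategy_def intervention_system_def no_later_interventions_def[abs_def] initial_holding_def[abs_def]
    using last[of 1, unfolded no_later_interventions_def[abs_def]] by (auto intro: stopping_time_const)
  moreover have "AE \<omega> in M. \<forall>t\<in>{0..1}. - a * s0 \<le> gains \<kappa> S no_later_interventions (initial_holding a) t \<omega>"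
    using AE_space
  proof (eventually_elim, intro ballI)
    fix \<omega> and t :: real assume "\<omega> \<in> space M" "t \<in> {0..1}"
    then have "0 \<le> a * S t \<omega>" using a S_pos[of t \<omega>] by simp
    then show "- a * s0 \<le> gains \<kappa> S no_later_interventions (initial_holding a) t \<omega>"
      using gains[OF \<open>t \<in> {0..1}\<close> \<open>\<omega> \<in> space M\<close>] by (simp add: algebra_simps)
  qed
  moreover have "AE \<omega> in M. f (S 1 \<omega>) \<le>
      f 0 + s0 * a + gains \<kappa> S no_later_interventions (initial_holding a) 1 \<omega>"
    using AE_space
  proof eventually_elim
    case (elim \<omega>)
    then show ?case using gains[of 1 \<omega>] dom[of "S 1 \<omega>"] S_pos[of 1 \<omega>] by (simp add: algebra_simps)
  qed
  ultimately show ?thesis by (auto simp: super_hedge_def admissible_def)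
qed

end

section \<open>The price from the lower bound over all tangents and the upper bound by buying and
  holding\<close>

theorem theorem3p1:
  fixes M :: "'a measure" and F :: "real \<Rightarrow> 'a measure" and S :: "real \<Rightarrow> 'a \<Rightarrow> real"
    and s0 \<kappa> :: real and f :: "real \<Rightarrow> real" and side :: "real \<Rightarrow> real filter"
  assumes "prob_space M"
    and "filtration (space M) F"
    and "\<And>t. t \<in> {0..1} \<Longrightarrow> subalgebra M (F t)"
    and "progressively_measurable F S"
    and "\<And>t \<omega>. t \<in> {0..1} \<Longrightarrow> \<omega> \<in> space M \<Longrightarrow> 0 < S t \<omega>"
    and "\<And>\<omega>. \<omega> \<in> space M \<Longrightarrow> continuous_on {0..1} (\<lambda>t. S t \<omega>)"
    and "\<And>\<omega>. \<omega> \<in> space M \<Longrightarrow> S 0 \<omega> = s0"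
    and "0 < s0"
    and "conditional_full_support M F S"
    and "0 < \<kappa>"
    and "continuous_on {0..} f"
    and "convex_on {0..} f"
    and "\<And>\<omega>. \<omega> \<in> space M \<Longrightarrow> 0 \<le> f (S 1 \<omega>)"
    and "side \<in> {at_left, at_right}"
  shows "super_replication_price M F S \<kappa> (\<lambda>\<omega>. f (S 1 \<omega>))
           = ereal (f 0) + ereal s0 * slope_at_infinity side f
       \<and> (slope_at_infinity side f < \<infinity> \<longrightarrow>
            (\<bar>super_replication_price M F S \<kappa> (\<lambda>\<omega>. f (S 1 \<omega>))\<bar> \<noteq> \<infinity> \<and>
             super_hedge M F S \<kappa> (\<lambda>\<omega>. f (S 1 \<omega>))
              (real_of_ereal (super_replication_price M F S \<kappa> (\<lambda>\<omega>. f (S 1 \<omega>))))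
              no_later_interventions (initial_holding (real_of_ereal (slope_at_infinity side f)))))"
proof -
  interpret cfs_market M F S s0
    by (intro cfs_market.intro cfs_market_axioms.intro assms)
  let ?d = "\<lambda>s. vector_derivative f (side s)" and ?\<sigma> = "slope_at_infinity side f"
  let ?price = "super_replication_price M F S \<kappa> (\<lambda>\<omega>. f (S 1 \<omega>))"
  note subgradient = convex_on_one_sided_derivative_subgradient[OF \<open>convex_on {0..} f\<close> _ _ \<open>side \<in> _\<close>]
  have d_le: "ereal (?d s) \<le> ?\<sigma>" if "0 < s" for s
    using that by (auto simp: slope_at_infinity_def intro!: SUP_upper)
  have \<sigma>_minf: "?\<sigma> \<noteq> - \<infinity>" using d_le[of 1] by auto
  have lower: "ereal (f 0) + ereal s0 * ?\<sigma> \<le> ?price"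
    unfolding super_replication_price_def
  proof (rule INF_greatest, clarsimp)
    fix x \<tau> h assume "super_hedge M F S \<kappa> (\<lambda>\<omega>. f (S 1 \<omega>)) x \<tau> h"
    then interpret hedging M F S s0 \<kappa> x f \<tau> h
      using \<open>0 < \<kappa>\<close> by unfold_locales
    \<comment> \<open>The tangent at \<open>s\<close> is the affine minorant, with
      \<open>- C\<close> as its intercept; the supremum over \<open>s\<close> is taken
      afterwards.\<close>
    have "?d s \<le> (x - f 0) / s0" if "0 < s" for s
    proof -
      have "f 0 + s0 * ?d s \<le> x"
        using subgradient[OF that] \<open>continuous_on {0..} f\<close>
        by (intro initial_capital_ge[where C="s * ?d s - f s"]) (simp_all add: algebra_simps)
      then show ?thesis using \<open>0 < s0\<close> by (simp add: field_simps)
    qed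
    then have "?\<sigma> \<le> ereal ((x - f 0) / s0)"
      unfolding slope_at_infinity_def by (intro SUP_least) auto
    then show "ereal (f 0) + ereal s0 * ?\<sigma> \<le> ereal x"
      using \<open>0 < s0\<close> \<sigma>_minf by (cases ?\<sigma>) (auto simp: field_simps)
  qed
  have upper: "?price \<le> ereal (f 0 + s0 * a) \<and>
      super_hedge M F S \<kappa> (\<lambda>\<omega>. f (S 1 \<omega>)) (f 0 + s0 * a) no_later_interventions (initial_holding a)"
    if a: "?\<sigma> = ereal a" for a
  proof -
    \<comment> \<open>The tangent at \<open>y\<close>, evaluated at 0, bounds
      \<open>f y - f 0\<close> by \<open>?d y * y\<close>.\<close>
    have dom: "f y \<le> f 0 + a * y" if "0 \<le> y" for y
    proof (cases "y = 0")
      case False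
      then have "f y + ?d y * (0 - y) \<le> f 0" "?d y \<le> a"
        using subgradient[of y 0] d_le[of y] that a by auto
      moreover have "?d y * y \<le> a * y" using \<open>?d y \<le> a\<close> that by (rule mult_right_mono)
      ultimately show ?thesis by simp
    qed simp
    have "0 \<le> a"
    proof (rule ccontr)
      assume "\<not> 0 \<le> a"
      \<comment> \<open>At this point the dominating line with negative slope \<open>a\<close> takes
        the value -1, which a nonnegative \<open>f\<close> cannot lie below.\<close>
      define y where "y = (f 0 + 1) / - a"
      have f_nonneg: "0 \<le> f z" if "0 \<le> z" for z
        using payoff_nonneg[OF \<open>continuous_on {0..} f\<close> _ \<open>0 < s0\<close> that] assms(13) by blast
      have "0 \<le> y" using \<open>\<not> 0 \<le> a\<close> f_nonneg[of 0] unfolding y_def by (intro divide_nonneg_pos) auto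
      moreover have "f 0 + a * y = - 1" using \<open>\<not> 0 \<le> a\<close> by (simp add: y_def)
      ultimately show False using dom[of y] f_nonneg[of y] by linarith
    qed
    from super_hedge_buy_and_hold[OF this dom] show ?thesis
      unfolding super_replication_price_def by (auto intro!: INF_lower)
  qed
  show ?thesis
  proof (cases ?\<sigma>)
    case (real a)
    have "?price = ereal (f 0 + s0 * a)"
      using lower upper[OF real] unfolding real by (intro antisym) simp_all
    then show ?thesis using upper[OF real] by (simp add: real)
  next
    case PInf
    then show ?thesis using lower \<open>0 < s0\<close> by auto
  qed (use \<sigma>_minf in simp)
qed

end
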